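(* Let $N \geq 2$ and let $a_1,\dots,a_N$ be positive integers with $\gcd(a_1,\dots,a_N)=1$; write ${\boldsymbol a}=(a_1,\dots,a_N)$, and let $s\ge 0$ be an integer. Then $$g_s({\boldsymbol a}) \leq \max \left\{ \frac{(N-1) R_{{\boldsymbol a}}}{r(1)} + 1,\ \left( \left( \frac{(N-1) R_{{\boldsymbol a}}}{r(1)} + 1 \right) s\, (N-1)! \prod_{i=1}^N a_i \right)^{\frac{1}{N-1}} \right\}.$$
   Context: A positive integer $t$ is representable by ${\boldsymbol a}$ if $t=\sum_{i=1}^N a_ix_i$ with $x_1,\dots,x_N$ nonnegative integers; each such ${\boldsymbol x}$ is a representation of $t$. For an integer $s\ge 0$, the $s$-Frobenius number $g_s({\boldsymbol a})$ is the largest positive integer that has precisely $s$ distinct representations in terms of ${\boldsymbol a}$. Let $\Lambda_{{\boldsymbol a}} = \{{\boldsymbol x}\in\mathbb{Z}^N : \sum_{i} a_ix_i=0\}$ and $V_{{\boldsymbol a}}=\operatorname{span}_{\mathbb R}\Lambda_{{\boldsymbol a}}$ (dimension $N-1$), with $B_{V_{{\boldsymbol a}}}(R)$ the closed ball of radius $R$ centered at the origin in $V_{{\boldsymbol a}}$. The covering radius is $R_{{\boldsymbol a}} := \inf\{R>0 : \Lambda_{{\boldsymbol a}} + B_{V_{{\boldsymbol a}}}(R) = V_{{\boldsymbol a}}\}$. $S(1)$ is the $(N-1)$-dimensional simplex $\{{\boldsymbol x}\in\mathbb{R}^N_{\ge 0} : \sum_{i=1}^N a_ix_i = 1\}$,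 and $r(1)$ is its inradius, i.e. the radius of the largest $(N-1)$-dimensional ball contained in $S(1)$ within the hyperplane $\sum_i a_ix_i=1$. *)

theory Defs
  imports "HOL-Analysis.Analysis"
begin

definition representations :: "nat ^ 'n \<Rightarrow> nat \<Rightarrow> (nat ^ 'n) set" where
  "representations a t = {x. (\<Sum>i\<in>UNIV. a $ i * x $ i) = t}"

text \<open>
  For some \<open>s\<close> no positive integer has exactly \<open>s\<close> representations, e.g. \<open>a = (1, 1)\<close> with
  \<open>s = 0\<close> or \<open>s = 1\<close>; the usual convention is then \<open>g\<^sub>s(a) = 0\<close>.  For positive, coprime \<open>a\<close>
  in dimension at least 2 the set below is finite, so \<open>Max\<close> is a genuine maximum.
\<close>

definition frobenius_number :: "nat \<Rightarrow> nat ^ 'n \<Rightarrow> nat" where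
  "frobenius_number s a =
     (let T = {t. 0 < t \<and> card (representations a t) = s}
      in if T = {} then 0 else Max T)"

definition orthogonal_lattice :: "nat ^ 'n \<Rightarrow> (real ^ 'n) set" where
  "orthogonal_lattice a = {x. (\<forall>i. x $ i \<in> \<int>) \<and> (\<Sum>i\<in>UNIV. real (a $ i) * x $ i) = 0}"

definition lattice_space :: "nat ^ 'n \<Rightarrow> (real ^ 'n) set" where
  "lattice_space a = span (orthogonal_lattice a)"

definition covering_radius :: "nat ^ 'n \<Rightarrow> real" where
  "covering_radius a =
     Inf {R. 0 < R \<and>
             {x + y | x y. x \<in> orthogonal_lattice a \<and> y \<in> cball 0 R \<inter> lattice_space a} = lattice_space a}"

definition weighted_hyperplane :: "nat ^ 'n \<Rightarrow> real \<Rightarrow> (real ^ 'n) set" where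
  "weighted_hyperplane a t = {x. (\<Sum>i\<in>UNIV. real (a $ i) * x $ i) = t}"

definition weighted_simplex :: "nat ^ 'n \<Rightarrow> real \<Rightarrow> (real ^ 'n) set" where
  "weighted_simplex a t = {x \<in> weighted_hyperplane a t. \<forall>i. 0 \<le> x $ i}"

text \<open>
  The centre must lie in the hyperplane: otherwise the intersection with the hyperplane is not
  a ball of radius \<open>r\<close>, and may be empty.
\<close>

definition inradius :: "nat ^ 'n \<Rightarrow> real \<Rightarrow> real" where
  "inradius a t =
     Sup {r. 0 < r \<and> (\<exists>c \<in> weighted_hyperplane a t.
                         cball c r \<inter> weighted_hyperplane a t \<subseteq> weighted_simplex a t)}"

end

theory Submission
  imports Defs
begin

text \<open>
  Write \<open>q = R\<^sub>a / r(1)\<close>.  The simplex \<open>S(t)\<close> contains a translate of \<open>S(t - q)\<close> all of whose points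
  are at distance at least \<open>R\<^sub>a\<close> from the relative boundary, so each of them is within \<open>R\<^sub>a\<close> of a
  representation of \<open>t\<close>.  Comparing volumes, \<open>t\<close> has at least \<open>(t - q)^(N-1) / ((N-1)! a\<^sub>1 \<dots> a\<^sub>N)\<close>
  representations, and Bernoulli's inequality gives \<open>t^(N-1) \<le> ((N-1) q + 1) (t - q)^(N-1)\<close> once
  \<open>t \<ge> (N-1) q + 1\<close>.  The volumes are compared in \<open>\<real>\<^sup>N\<close> rather than in the hyperplane, after
  thickening everything by one unit of \<open>a \<bullet> x\<close>: then \<open>\<int>\<^sup>N\<close>, of covolume one, replaces the lattice.
\<close>

section \<open>Lebesgue measure and integer translates\<close>

lemma emeasure_lborel_shift:
  fixes v :: "'a::euclidean_space"
  assumes "S \<in> sets borel"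
  shows "emeasure lborel {x. x - v \<in> S} = emeasure lborel S"
proof -
  have "emeasure lborel S = emeasure (distr lborel borel ((+) (- v))) S"
    by (simp add: lborel_distr_plus)
  also have "\<dots> = emeasure lborel {x. x - v \<in> S}"
    using assms by (subst emeasure_distr) (auto simp: vimage_def)
  finally show ?thesis by simp
qed

lemma sets_borel_shift:
  fixes v :: "'a::euclidean_space"
  assumes "S \<in> sets borel"
  shows "{x. x - v \<in> S} \<in> sets borel"
proof -
  have "(\<lambda>x. x - v) -` S \<inter> space borel \<in> sets borel"
    by (rule measurable_sets) (use assms in auto)
  then show ?thesis by (simp add: vimage_def)
qed

text \<open>Any measurable set whose integer translates cover the space contains one of measure at most
  one with the same property: move every point of the unit cube by the first integer vector (in some
  enumeration) that takes it into the set.\<close>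

lemma integer_translates_cover_small:
  fixes C :: "(real ^ 'n) set"
  assumes C: "C \<in> sets borel"
    and cover: "\<And>x. \<exists>z. (\<forall>i. z $ i \<in> \<int>) \<and> x - z \<in> C"
  obtains F where "F \<subseteq> C" "F \<in> sets borel" "emeasure lborel F \<le> 1"
    "\<And>x. \<exists>z. (\<forall>i. z $ i \<in> \<int>) \<and> x - z \<in> F"
proof -
  \<comment> \<open>Enumerates the integer vectors through the countable type of integer-valued
    functions on the index type. Repetitions are harmless, because \<open>disjointed\<close> keeps
    only the first index.\<close>
  define e :: "nat \<Rightarrow> real ^ 'n" where "e k = (\<chi> i. of_int ((from_nat k :: 'n \<Rightarrow> int) i))" for k
  have e_int: "e k $ i \<in> \<int>" for k i by (simp add: e_def)
  have e_surj: "\<exists>k. z = e k" if "\<forall>i. z $ i \<in> \<int>" for z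
  proof
    show "z = e (to_nat (\<lambda>i. \<lfloor>z $ i\<rfloor>))"
      using that by (simp add: e_def vec_eq_iff)
  qed
  define U :: "(real ^ 'n) set" where "U = cbox 0 1"
  define V where "V k = {x. x - e k \<in> C}" for k
  have V: "V k \<in> sets borel" for k unfolding V_def by (rule sets_borel_shift[OF C])
  \<comment> \<open>\<open>W k\<close> holds the points of the unit cube for which \<open>k\<close>
    is the first index with \<open>x - e k\<close> in \<open>C\<close>. These pieces partition the
    cube.\<close>
  define W where "W k = U \<inter> disjointed V k" for k
  have dV: "disjointed V k \<in> sets borel" for k
    using V sets.range_disjointed_sets[of V borel] by (auto simp: subset_iff image_iff)
  have W: "W k \<in> sets borel" for k
    unfolding W_def U_def using dV by auto
  \<comment> \<open>Each piece is moved by its own \<open>- e k\<close>. The moved pieces may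
    overlap, so their union has measure at most that of the cube, with no equality claimed.\<close>
  define F where "F = (\<Union>k. {x. x - (- e k) \<in> W k})"
  have meas: "{x. x - (- e k) \<in> W k} \<in> sets borel" for k by (rule sets_borel_shift[OF W])
  show thesis
  proof
    show "F \<subseteq> C"
      using disjointed_subset[of V] by (fastforce simp: F_def W_def V_def)
    show "F \<in> sets borel" unfolding F_def using meas by auto
    have "emeasure lborel F \<le> (\<Sum>k. emeasure lborel {x. x - (- e k) \<in> W k})"
      unfolding F_def using meas by (intro emeasure_subadditive_countably) auto
    also have "\<dots> = (\<Sum>k. emeasure lborel (W k))"
      by (simp only: emeasure_lborel_shift[OF W])
    also have "\<dots> = emeasure lborel (\<Union>k. W k)"
      using W disjoint_family_disjointed[of V]
      by (intro suminf_emeasure) (auto simp: disjoint_family_on_def W_def)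
    also have "\<dots> \<le> emeasure lborel U"
      by (intro emeasure_mono) (auto simp: W_def U_def)
    also have "\<dots> = 1"
      unfolding U_def by (subst emeasure_lborel_cbox) (auto simp: Basis_vec_def inner_axis intro!: prod.neutral)
    finally show "emeasure lborel F \<le> 1" .
    fix x :: "real ^ 'n"
    \<comment> \<open>Two integer moves bring \<open>x\<close> into \<open>F\<close>:
      \<open>f\<close> takes it into the unit cube, then \<open>e k\<close> takes it into
      \<open>C\<close>.\<close>
    define f where "f = (\<chi> i. real_of_int \<lfloor>x $ i\<rfloor>)"
    have fU: "x - f \<in> U"
      by (auto simp: U_def f_def mem_box_cart intro: order.strict_implies_order) linarith
    obtain z where "\<forall>i. z $ i \<in> \<int>" "x - f - z \<in> C" using cover[of "x - f"] by blast
    with e_surj obtain k where "x - f - e k \<in> C" by blast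
    then have "x - f \<in> (\<Union>k. V k)" by (auto simp: V_def)
    then obtain k where "x - f \<in> disjointed V k" by (metis UN_disjointed_eq UN_iff)
    then have "x - (f + e k) - (- e k) \<in> W k" using fU by (simp add: W_def)
    then have "x - (f + e k) \<in> F" unfolding F_def by blast
    moreover have "\<forall>i. (f + e k) $ i \<in> \<int>" by (simp add: f_def e_int)
    ultimately show "\<exists>z. (\<forall>i. z $ i \<in> \<int>) \<and> x - z \<in> F" by blast
  qed
qed

section \<open>Volumes of simplices, slices and prisms\<close>

text \<open>A diagonal linear map carries the standard simplex to this one, so compactness and the
  volume formula both follow from the standard simplex, whose volume is known.\<close>

lemma corner_simplex_eq_stretch:
  fixes w :: "real ^ 'n"
  assumes w: "\<And>i. 0 < w $ i" and t: "0 < t"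
  shows "{x. (\<forall>i. 0 \<le> x $ i) \<and> w \<bullet> x \<le> t} =
    (\<lambda>x. \<chi> i. t / w $ i * x $ i) ` (convex hull (insert 0 Basis))" (is "?L = ?f ` ?S")
proof -
  have S: "?S = {x. (\<forall>i. 0 \<le> x $ i) \<and> (\<Sum>i\<in>UNIV. x $ i) \<le> 1}"
  proof -
    have "(\<Sum>b\<in>Basis. x \<bullet> b) = (\<Sum>i\<in>UNIV. x $ i)" for x :: "real ^ 'n"
      by (simp add: Basis_vec_def UNION_singleton_eq_range sum.reindex inj_on_def axis_eq_axis
          inner_axis)
    then show ?thesis
      unfolding std_simplex by (auto simp: Basis_vec_def inner_axis)
  qed
  have "x \<in> ?f ` ?S" if "x \<in> ?L" for x
  proof
    show "x = ?f (\<chi> i. w $ i * x $ i / t)"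
      using w t by (simp add: vec_eq_iff less_imp_neq[symmetric])
    show "(\<chi> i. w $ i * x $ i / t) \<in> ?S"
      using that w t unfolding S
      by (auto simp: inner_vec_def sum_divide_distrib[symmetric] less_imp_le)
  qed
  moreover have "?f x \<in> ?L" if "x \<in> ?S" for x
  proof -
    have "w \<bullet> ?f x = t * (\<Sum>i\<in>UNIV. x $ i)"
      using w by (simp add: inner_vec_def sum_distrib_left less_imp_neq[symmetric])
    then show ?thesis
      using that w t unfolding S by (auto simp: less_imp_le)
  qed
  ultimately show ?thesis by auto
qed

lemma compact_corner_simplex:
  fixes w :: "real ^ 'n"
  assumes w: "\<And>i. 0 < w $ i" and t: "0 < t"
  shows "compact {x. (\<forall>i. 0 \<le> x $ i) \<and> w \<bullet> x \<le> t}"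
  unfolding corner_simplex_eq_stretch[OF assms]
  by (intro compact_continuous_image continuous_intros compact_convex_hull finite_imp_compact)
    auto

lemma measure_corner_simplex:
  fixes w :: "real ^ 'n"
  assumes w: "\<And>i. 0 < w $ i" and t: "0 < t"
  shows "measure lborel {x. (\<forall>i. 0 \<le> x $ i) \<and> w \<bullet> x \<le> t} =
    t ^ CARD('n) / (fact CARD('n) * (\<Prod>i\<in>UNIV. w $ i))"
proof -
  let ?S = "convex hull (insert 0 Basis) :: (real ^ 'n) set"
  have cS: "compact ?S" by (intro compact_convex_hull finite_imp_compact) auto
  have "measure lborel {x. (\<forall>i. 0 \<le> x $ i) \<and> w \<bullet> x \<le> t} =
    measure lebesgue ((\<lambda>x. \<chi> i. t / w $ i * x $ i) ` ?S)"
    unfolding corner_simplex_eq_stretch[OF assms, symmetric]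
    using compact_imp_closed[OF compact_corner_simplex[OF assms]]
    by (subst measure_completion) auto
  also have "\<dots> = \<bar>\<Prod>i\<in>UNIV. t / w $ i\<bar> * measure lebesgue ?S"
    by (rule measure_stretch) (simp add: lmeasurable_compact cS)
  also have "measure lebesgue ?S = 1 / fact CARD('n)"
    using content_std_simplex[where 'a="real ^ 'n"] compact_imp_closed[OF cS]
    by (subst measure_completion) auto
  also have "\<bar>\<Prod>i\<in>UNIV. t / w $ i\<bar> = t ^ CARD('n) / (\<Prod>i\<in>UNIV. w $ i)"
    using w t by (simp add: prod_dividef abs_of_nonneg prod_nonneg less_imp_le)
  finally show ?thesis by (simp add: field_simps)
qed

lemma sets_borel_slice:
  fixes w :: "real ^ 'n"
  shows "{x. (\<forall>i. 0 \<le> x $ i) \<and> l < w \<bullet> x \<and> w \<bullet> x \<le> u} \<in> sets borel"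
proof -
  have "{x. (\<forall>i. 0 \<le> x $ i) \<and> l < w \<bullet> x \<and> w \<bullet> x \<le> u} =
    (\<Inter>i. {x. 0 \<le> x $ i}) \<inter> {x. l < w \<bullet> x} \<inter> {x. w \<bullet> x \<le> u}"
    by auto
  also have "\<dots> \<in> sets borel"
    by (intro sets.Int borel_closed borel_open closed_INT ballI closed_Collect_le open_Collect_less
        continuous_intros)
  finally show ?thesis .
qed

text \<open>When \<open>w \<bullet> p = 1\<close>, subtracting
  \<open>(w \<bullet> x - t) *\<^sub>R p\<close> projects \<open>x\<close> along \<open>p\<close>
  onto the level \<open>t\<close>. The set is then the simplex at level \<open>t\<close> swept along
  \<open>p\<close> through one unit of \<open>w \<bullet> x\<close>.\<close>

lemma sets_borel_prism:
  fixes w p :: "real ^ 'n"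
  shows "{x. t < w \<bullet> x \<and> w \<bullet> x \<le> t + 1 \<and> (\<forall>i. 0 \<le> (x - (w \<bullet> x - t) *\<^sub>R p) $ i)} \<in> sets borel"
proof -
  have "{x. t < w \<bullet> x \<and> w \<bullet> x \<le> t + 1 \<and> (\<forall>i. 0 \<le> (x - (w \<bullet> x - t) *\<^sub>R p) $ i)} =
    (\<Inter>i. {x. 0 \<le> (x - (w \<bullet> x - t) *\<^sub>R p) $ i}) \<inter> {x. t < w \<bullet> x} \<inter> {x. w \<bullet> x \<le> t + 1}"
    by auto
  also have "\<dots> \<in> sets borel"
    by (intro sets.Int borel_closed borel_open closed_INT ballI closed_Collect_le open_Collect_less
        continuous_intros)
  finally show ?thesis .
qed

lemma emeasure_slice:
  fixes w :: "real ^ 'n"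
  assumes w: "\<And>i. 0 < w $ i" and "0 < l" "l \<le> u"
  shows "emeasure lborel {x. (\<forall>i. 0 \<le> x $ i) \<and> l < w \<bullet> x \<and> w \<bullet> x \<le> u} =
    ennreal ((u ^ CARD('n) - l ^ CARD('n)) / (fact CARD('n) * (\<Prod>i\<in>UNIV. w $ i)))"
proof -
  let ?D = "\<lambda>t. {x. (\<forall>i. 0 \<le> x $ i) \<and> w \<bullet> x \<le> t}"
  have fin: "emeasure lborel (?D t) < \<infinity>" and meas: "?D t \<in> sets borel" if "0 < t" for t
    using emeasure_compact_finite[OF compact_corner_simplex[OF w that]]
      compact_imp_closed[OF compact_corner_simplex[OF w that]] by auto
  have eq: "{x. (\<forall>i. 0 \<le> x $ i) \<and> l < w \<bullet> x \<and> w \<bullet> x \<le> u} = ?D u - ?D l"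
    by auto
  have em: "emeasure lborel (?D t) =
      ennreal (t ^ CARD('n) / (fact CARD('n) * (\<Prod>i\<in>UNIV. w $ i)))" if "0 < t" for t
    using fin[OF that] measure_corner_simplex[OF w that]
    by (subst emeasure_eq_ennreal_measure) (auto simp: less_top)
  have "emeasure lborel (?D u - ?D l) = emeasure lborel (?D u) - emeasure lborel (?D l)"
    using assms meas[of u] meas[of l] fin[of l] by (intro emeasure_Diff) auto
  also have "\<dots> = ennreal (u ^ CARD('n) / (fact CARD('n) * (\<Prod>i\<in>UNIV. w $ i)) -
      l ^ CARD('n) / (fact CARD('n) * (\<Prod>i\<in>UNIV. w $ i)))"
    using assms by (subst (1 2) em)
      (auto intro!: ennreal_minus divide_nonneg_nonneg mult_nonneg_nonneg prod_nonneg simp: less_imp_le)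
  finally show ?thesis unfolding eq by (simp add: diff_divide_distrib)
qed

text \<open>This is the difference quotient of \<open>t ^ N\<close> with step
  \<open>- 1 / (m + 1)\<close>. It evaluates, up to a constant factor, the total volume of
  \<open>m + 1\<close> slices of thickness \<open>1 / (m + 1)\<close> in the limit.\<close>

lemma power_difference_quotient_LIMSEQ:
  fixes t :: real
  shows "(\<lambda>m. real (Suc m) * (t ^ N - (t - 1 / real (Suc m)) ^ N)) \<longlonglongrightarrow> real N * t ^ (N - 1)"
proof -
  have lim: "((\<lambda>h. ((t + h) ^ N - t ^ N) / h) \<longlongrightarrow> real N * t ^ (N - 1)) (at 0)"
    using DERIV_pow[of N t UNIV] by (simp add: DERIV_def)
  have "filterlim (\<lambda>m. - (1 / real (Suc m))) (at 0) sequentially"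
    unfolding filterlim_at
    using tendsto_minus[OF LIMSEQ_inverse_real_of_nat] by (auto simp: inverse_eq_divide)
  from filterlim_compose[OF lim this] show ?thesis
    by (rule Lim_transform_eventually) (simp add: mult.commute algebra_simps)
qed

text \<open>Fubini in disguise: for every \<open>m\<close>, \<open>m\<close> disjoint translates along \<open>p\<close> of the slice
  \<open>t - 1/m < w \<bullet> x \<le> t\<close> of the positive orthant fit into the prism.\<close>

lemma emeasure_prism_ge:
  fixes w p :: "real ^ 'n"
  assumes w: "\<And>i. 0 < w $ i" and t: "0 < t" and p: "\<And>i. 0 \<le> p $ i" and wp: "w \<bullet> p = 1"
  shows "ennreal (t ^ (CARD('n) - 1) / (fact (CARD('n) - 1) * (\<Prod>i\<in>UNIV. w $ i))) \<le>
    emeasure lborel {x. t < w \<bullet> x \<and> w \<bullet> x \<le> t + 1 \<and> (\<forall>i. 0 \<le> (x - (w \<bullet> x - t) *\<^sub>R p) $ i)}"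
    (is "_ \<le> emeasure lborel ?P")
proof (rule LIMSEQ_le_const2)
  let ?N = "CARD('n)"
  let ?c = "\<lambda>m. real (Suc m) * (t ^ ?N - (t - 1 / real (Suc m)) ^ ?N) /
    (fact ?N * (\<Prod>i\<in>UNIV. w $ i))"
  have pos: "(\<Prod>i\<in>UNIV. w $ i) > 0" using w by (simp add: prod_pos)
  have "0 < fact ?N * (\<Prod>i\<in>UNIV. w $ i)" by (intro mult_pos_pos pos) simp
  then have ne: "fact ?N * (\<Prod>i\<in>UNIV. w $ i) \<noteq> 0" by (rule less_imp_neq[symmetric])
  have N: "fact ?N = real ?N * fact (?N - 1)"
    by (rule fact_reduce) simp
  have "?c \<longlonglongrightarrow> real ?N * t ^ (?N - 1) / (fact ?N * (\<Prod>i\<in>UNIV. w $ i))"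
    by (rule tendsto_divide[OF power_difference_quotient_LIMSEQ tendsto_const ne])
  also have "real ?N * t ^ (?N - 1) / (fact ?N * (\<Prod>i\<in>UNIV. w $ i)) =
      t ^ (?N - 1) / (fact (?N - 1) * (\<Prod>i\<in>UNIV. w $ i))"
    unfolding N by simp
  finally show "(\<lambda>m. ennreal (?c m)) \<longlonglongrightarrow>
      ennreal (t ^ (?N - 1) / (fact (?N - 1) * (\<Prod>i\<in>UNIV. w $ i)))"
    by (rule tendsto_ennrealI)
  \<comment> \<open>From \<open>M\<close> on, the lower level \<open>t - 1 / (m + 1)\<close> of the
    slice is positive, as the volume formula for slices demands.\<close>
  obtain M where M: "1 / real (Suc M) < t"
    using reals_Archimedean[OF t] by (auto simp: inverse_eq_divide)
  have "ennreal (?c m) \<le> emeasure lborel ?P" if "m \<ge> M" for m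
  proof -
    define n where "n = real (Suc m)"
    have n: "n > 0" by (simp add: n_def)
    have "1 / n \<le> 1 / real (Suc M)" using that by (simp add: n_def field_simps)
    with M have nt: "1 / n < t" by simp
    define E where "E = {x. (\<forall>i. 0 \<le> x $ i) \<and> t - 1 / n < w \<bullet> x \<and> w \<bullet> x \<le> t}"
    \<comment> \<open>The shift raises the levels of \<open>E\<close> to the half-open interval from
      \<open>t + k / n\<close> to \<open>t + (k + 1) / n\<close>. For \<open>k\<close> up to
      \<open>m\<close> these \<open>n = m + 1\<close> intervals are disjoint and fill one unit above
      \<open>t\<close>.\<close>
    define G where "G k = {x. x - ((real k + 1) / n) *\<^sub>R p \<in> E}" for k
    have E: "E \<in> sets borel" unfolding E_def by (rule sets_borel_slice)
    have G: "G k \<in> sets borel" for k unfolding G_def by (rule sets_borel_shift[OF E])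
    have Gw: "t + real k / n < w \<bullet> x \<and> w \<bullet> x \<le> t + (real k + 1) / n" if "x \<in> G k" for x k
      using that by (auto simp: G_def E_def inner_diff_right wp add_divide_distrib)
    have disj: "disjoint_family_on G {..m}"
    proof -
      have "False" if "x \<in> G k" "x \<in> G l" "k < l" for x k l
      proof -
        have "real k + 1 \<le> real l" using that by linarith
        then have "(real k + 1) / n \<le> real l / n" using n by (simp add: divide_right_mono)
        then show False using Gw[OF that(1)] Gw[OF that(2)] by linarith
      qed
      then show ?thesis
        unfolding disjoint_family_on_def by (metis disjoint_iff linorder_neqE_nat)
    qed
    have GP: "G k \<subseteq> ?P" if "k \<le> m" for k
    proof
      fix x assume x: "x \<in> G k"
      define y where "y = x - ((real k + 1) / n) *\<^sub>R p"
      have yE: "y \<in> E" using x by (simp add: G_def y_def)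
      have wx: "w \<bullet> x = w \<bullet> y + (real k + 1) / n" by (simp add: y_def inner_diff_right wp)
      have "(real k + 1) / n \<le> 1" using that n by (simp add: n_def)
      moreover have "0 \<le> real k / n" using n by simp
      ultimately have "t < w \<bullet> x" "w \<bullet> x \<le> t + 1" using Gw[OF x] by linarith+
      moreover have "0 \<le> (x - (w \<bullet> x - t) *\<^sub>R p) $ i" for i
      proof -
        \<comment> \<open>Projecting \<open>x\<close> back to level \<open>t\<close> amounts to
          raising \<open>y\<close> from its own level, which is at most \<open>t\<close>. This adds
          a nonnegative multiple of \<open>p\<close>.\<close>
        have "x - (w \<bullet> x - t) *\<^sub>R p = y + (t - w \<bullet> y) *\<^sub>R p"
          unfolding wx by (simp add: y_def algebra_simps)
        then show ?thesis using yE p[of i] by (simp add: E_def)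
      qed
      ultimately show "x \<in> ?P" by simp
    qed
    have "ennreal (?c m) = (\<Sum>k\<le>m. ennreal ((t ^ ?N - (t - 1 / n) ^ ?N) /
        (fact ?N * (\<Prod>i\<in>UNIV. w $ i))))"
    proof -
      have "0 \<le> (t ^ ?N - (t - 1 / n) ^ ?N) / (fact ?N * (\<Prod>i\<in>UNIV. w $ i))"
        using pos nt n by (auto intro!: divide_nonneg_nonneg power_mono)
      then show ?thesis
        unfolding n_def by (subst sum_ennreal) (auto simp del: of_nat_Suc)
    qed
    also have "\<dots> = (\<Sum>k\<le>m. emeasure lborel (G k))"
    proof (rule sum.cong[OF refl])
      fix k
      have "emeasure lborel (G k) = emeasure lborel E"
        unfolding G_def by (rule emeasure_lborel_shift[OF E])
      also have "\<dots> = ennreal ((t ^ ?N - (t - 1 / n) ^ ?N) / (fact ?N * (\<Prod>i\<in>UNIV. w $ i)))"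
        unfolding E_def using nt n by (intro emeasure_slice[OF w]) auto
      finally show "ennreal ((t ^ ?N - (t - 1 / n) ^ ?N) / (fact ?N * (\<Prod>i\<in>UNIV. w $ i))) =
        emeasure lborel (G k)" ..
    qed
    also have "\<dots> = emeasure lborel (\<Union>k\<le>m. G k)"
      using G disj by (intro sum_emeasure) auto
    also have "\<dots> \<le> emeasure lborel ?P"
      using GP sets_borel_prism[of t w p] by (intro emeasure_mono) auto
    finally show ?thesis .
  qed
  then show "\<exists>M. \<forall>m\<ge>M. ennreal (?c m) \<le> emeasure lborel ?P" by blast
qed

section \<open>Bezout's identity, the orthogonal lattice and its covering radius\<close>

lemma bezout_finite_family:
  fixes f :: "'a \<Rightarrow> int"
  assumes "finite A"
  shows "\<exists>z. (\<Sum>i\<in>A. f i * z i) = Gcd (f ` A)"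
  using assms
proof (induction A)
  case empty
  then show ?case by simp
next
  case (insert j A)
  then obtain z where z: "(\<Sum>i\<in>A. f i * z i) = Gcd (f ` A)" by blast
  obtain u v where "u * f j + v * Gcd (f ` A) = gcd (f j) (Gcd (f ` A))"
    using bezout_int by blast
  then have "(\<Sum>i\<in>insert j A. f i * (if i = j then u else v * z i)) = Gcd (f ` insert j A)"
  proof -
    have "(\<Sum>i\<in>A. f i * (if i = j then u else v * z i)) = (\<Sum>i\<in>A. v * (f i * z i))"
      using insert.hyps by (intro sum.cong) auto
    also have "\<dots> = v * Gcd (f ` A)" by (simp add: z sum_distrib_left[symmetric])
    finally show ?thesis
      using insert.hyps \<open>u * f j + _ = _\<close> by (simp add: algebra_simps)
  qed
  then show ?case by (rule exI[where x="\<lambda>i. if i = j then u else v * z i"])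
qed

definition real_vec :: "nat ^ 'n \<Rightarrow> real ^ 'n" where
  "real_vec a = (\<chi> i. real (a $ i))"

lemma real_vec_inner: "real_vec a \<bullet> x = (\<Sum>i\<in>UNIV. real (a $ i) * x $ i)"
  by (simp add: real_vec_def inner_vec_def)

lemma real_vec_nth [simp]: "real_vec a $ i = real (a $ i)"
  by (simp add: real_vec_def)

lemma orthogonal_lattice_iff:
  "x \<in> orthogonal_lattice a \<longleftrightarrow> (\<forall>i. x $ i \<in> \<int>) \<and> real_vec a \<bullet> x = 0"
  by (simp add: orthogonal_lattice_def real_vec_inner)

lemma orthogonal_lattice_sum:
  assumes "\<And>i. i \<in> I \<Longrightarrow> g i \<in> orthogonal_lattice a"
  shows "(\<Sum>i\<in>I. of_int (m i) *\<^sub>R g i) \<in> orthogonal_lattice a"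
  using assms by (auto simp: orthogonal_lattice_iff inner_sum_right intro!: Ints_sum Ints_mult)

text \<open>For a fixed \<open>j\<close> the vectors \<open>a_j e_i - a_i e_j\<close> are integral,
  orthogonal to \<open>a\<close>, and span the hyperplane over the reals. They need not generate the
  lattice over the integers; a real spanning set is enough for the uses below.\<close>

lemma lattice_generators:
  fixes a :: "nat ^ 'n"
  assumes "\<And>i. a $ i > 0"
  obtains g :: "'n \<Rightarrow> real ^ 'n"
  where "\<And>i. g i \<in> orthogonal_lattice a"
    "\<And>x. real_vec a \<bullet> x = 0 \<Longrightarrow> \<exists>c. x = (\<Sum>i\<in>UNIV. c i *\<^sub>R g i)"
proof -
  obtain j :: 'n where True by blast
  define g where "g i = real (a $ j) *\<^sub>R axis i 1 - real (a $ i) *\<^sub>R axis j (1::real)" for i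
  show thesis
  proof
    show "g i \<in> orthogonal_lattice a" for i
      unfolding orthogonal_lattice_iff
    proof
      show "\<forall>k. g i $ k \<in> \<int>" by (simp add: g_def axis_def)
      show "real_vec a \<bullet> g i = 0" by (simp add: g_def inner_diff_right inner_axis)
    qed
    fix x assume x: "real_vec a \<bullet> x = 0"
    have "(\<Sum>i\<in>UNIV. (x $ i / real (a $ j)) *\<^sub>R g i) = (\<Sum>i\<in>UNIV. x $ i *\<^sub>R axis i 1) -
        (\<Sum>i\<in>UNIV. (real (a $ i) * x $ i) *\<^sub>R ((1 / real (a $ j)) *\<^sub>R axis j 1))"
      unfolding sum_subtractf[symmetric] g_def
      using assms[of j] by (intro sum.cong) (auto simp: scaleR_diff_right field_simps)
    also have "(\<Sum>i\<in>UNIV. (real (a $ i) * x $ i) *\<^sub>R ((1 / real (a $ j)) *\<^sub>R axis j (1::real))) = 0"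
      unfolding scaleR_sum_left[symmetric] using x by (simp add: real_vec_inner)
    also have "(\<Sum>i\<in>UNIV. x $ i *\<^sub>R axis i (1::real)) = x"
      using basis_expansion[of x] by (simp add: scalar_mult_eq_scaleR)
    finally show "\<exists>c. x = (\<Sum>i\<in>UNIV. c i *\<^sub>R g i)"
      by (intro exI[where x="\<lambda>i. x $ i / real (a $ j)"]) simp
  qed
qed

lemma lattice_space_eq:
  fixes a :: "nat ^ 'n"
  assumes "\<And>i. a $ i > 0"
  shows "lattice_space a = {x. real_vec a \<bullet> x = 0}"
proof
  have "subspace {x. real_vec a \<bullet> x = 0}" by (rule subspace_hyperplane)
  then show "lattice_space a \<subseteq> {x. real_vec a \<bullet> x = 0}"
    unfolding lattice_space_def by (intro span_minimal) (auto simp: orthogonal_lattice_iff)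
  obtain g :: "'n \<Rightarrow> real ^ 'n" where g: "\<And>i. g i \<in> orthogonal_lattice a"
    "\<And>x. real_vec a \<bullet> x = 0 \<Longrightarrow> \<exists>c. x = (\<Sum>i\<in>UNIV. c i *\<^sub>R g i)"
    using lattice_generators[OF assms] by blast
  show "{x. real_vec a \<bullet> x = 0} \<subseteq> lattice_space a"
    unfolding lattice_space_def
    using g(1) by (auto dest!: g(2) intro!: span_sum intro: span_scale span_base)
qed

text \<open>Lattice points and ball both lie in the hyperplane, so one inclusion is automatic and
  the other says that every point of the hyperplane is within \<open>R\<close> of the
  lattice.\<close>

lemma covering_radius_set_eq:
  fixes a :: "nat ^ 'n"
  assumes "\<And>i. a $ i > 0"
  shows "{x + y | x y. x \<in> orthogonal_lattice a \<and> y \<in> cball 0 R \<inter> lattice_space a} = lattice_space a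
    \<longleftrightarrow> (\<forall>v. real_vec a \<bullet> v = 0 \<longrightarrow> (\<exists>u\<in>orthogonal_lattice a. norm (v - u) \<le> R))" (is "?L = _ \<longleftrightarrow> ?R")
proof -
  have "?L \<subseteq> lattice_space a"
    by (auto simp: lattice_space_eq[OF assms] orthogonal_lattice_iff inner_add_right)
  then have "?L = lattice_space a \<longleftrightarrow> lattice_space a \<subseteq> ?L" by blast
  also have "\<dots> \<longleftrightarrow> ?R"
  proof
    assume *: "lattice_space a \<subseteq> ?L"
    show ?R
    proof (intro allI impI)
      fix v assume "real_vec a \<bullet> v = 0"
      with * obtain x y where "v = x + y" "x \<in> orthogonal_lattice a" "norm y \<le> R"
        by (force simp: lattice_space_eq[OF assms])
      then show "\<exists>u\<in>orthogonal_lattice a. norm (v - u) \<le> R" by force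
    qed
  next
    assume ?R
    show "lattice_space a \<subseteq> ?L"
    proof
      fix v assume "v \<in> lattice_space a"
      then have v: "real_vec a \<bullet> v = 0" by (simp add: lattice_space_eq[OF assms])
      with \<open>?R\<close> obtain u where u: "u \<in> orthogonal_lattice a" "norm (v - u) \<le> R" by blast
      then have "v - u \<in> cball 0 R \<inter> lattice_space a" using v
        by (simp add: lattice_space_eq[OF assms] inner_diff_right orthogonal_lattice_iff)
      moreover have "v = u + (v - u)" by simp
      ultimately show "v \<in> ?L" using u by blast
    qed
  qed
  finally show ?thesis .
qed

lemma covering_radius_eq:
  fixes a :: "nat ^ 'n"
  assumes "\<And>i. a $ i > 0"
  shows "covering_radius a = Inf {R. 0 < R \<and>
    (\<forall>v. real_vec a \<bullet> v = 0 \<longrightarrow> (\<exists>u\<in>orthogonal_lattice a. norm (v - u) \<le> R))}"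
  unfolding covering_radius_def covering_radius_set_eq[OF assms] ..

text \<open>Rounding the coefficients of \<open>v\<close> down leaves fractional parts, so the error
  is at most the sum of the norms of the spanning vectors. The infimum defining the covering radius
  is thus over a nonempty set.\<close>

lemma covering_radius_exists:
  fixes a :: "nat ^ 'n"
  assumes "\<And>i. a $ i > 0"
  shows "\<exists>R>0. \<forall>v. real_vec a \<bullet> v = 0 \<longrightarrow> (\<exists>u\<in>orthogonal_lattice a. norm (v - u) \<le> R)"
proof -
  obtain g :: "'n \<Rightarrow> real ^ 'n" where g: "\<And>i. g i \<in> orthogonal_lattice a"
    "\<And>x. real_vec a \<bullet> x = 0 \<Longrightarrow> \<exists>c. x = (\<Sum>i\<in>UNIV. c i *\<^sub>R g i)"
    using lattice_generators[OF assms] by blast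
  define R where "R = (\<Sum>i\<in>UNIV. norm (g i)) + 1"
  have "\<exists>u\<in>orthogonal_lattice a. norm (v - u) \<le> R" if v: "real_vec a \<bullet> v = 0" for v
  proof -
    obtain c where c: "v = (\<Sum>i\<in>UNIV. c i *\<^sub>R g i)" using g(2)[OF v] by blast
    let ?u = "\<Sum>i\<in>UNIV. of_int \<lfloor>c i\<rfloor> *\<^sub>R g i"
    have "norm (v - ?u) = norm (\<Sum>i\<in>UNIV. frac (c i) *\<^sub>R g i)"
      by (simp add: c frac_def scaleR_diff_left sum_subtractf)
    also have "\<dots> \<le> (\<Sum>i\<in>UNIV. norm (frac (c i) *\<^sub>R g i))" by (rule norm_sum)
    also have "\<dots> \<le> (\<Sum>i\<in>UNIV. norm (g i))"
      by (intro sum_mono) (auto simp: mult_left_le_one_le frac_ge_0 frac_lt_1 less_imp_le)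
    finally have "norm (v - ?u) \<le> R" by (simp add: R_def)
    moreover have "?u \<in> orthogonal_lattice a" by (rule orthogonal_lattice_sum[OF g(1)])
    ultimately show ?thesis by blast
  qed
  moreover have "R > 0" by (simp add: R_def sum_nonneg add_nonneg_pos)
  ultimately show ?thesis by blast
qed

lemma covering_radius_nonneg:
  fixes a :: "nat ^ 'n"
  assumes "\<And>i. a $ i > 0"
  shows "0 \<le> covering_radius a"
  unfolding covering_radius_eq[OF assms]
  using covering_radius_exists[OF assms] by (intro cInf_greatest) auto

text \<open>Working with a radius strictly above the infimum avoids proving that the infimum is
  attained.\<close>

lemma covering_radius_less:
  fixes a :: "nat ^ 'n"
  assumes "\<And>i. a $ i > 0" and "covering_radius a < R" and "real_vec a \<bullet> v = 0"
  shows "\<exists>u\<in>orthogonal_lattice a. norm (v - u) \<le> R"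
proof -
  have "\<exists>R'\<in>{R. 0 < R \<and>
    (\<forall>v. real_vec a \<bullet> v = 0 \<longrightarrow> (\<exists>u\<in>orthogonal_lattice a. norm (v - u) \<le> R))}. R' < R"
    using assms(2) covering_radius_exists[OF assms(1)]
    unfolding covering_radius_eq[OF assms(1)] by (intro cInf_lessD) auto
  then obtain R' where "R' < R" "\<exists>u\<in>orthogonal_lattice a. norm (v - u) \<le> R'"
    using assms(3) by blast
  then show ?thesis by (meson less_imp_le order.trans)
qed

section \<open>The inradius of the simplex\<close>

lemma inscribed_ball_iff:
  fixes a :: "nat ^ 'n"
  assumes "real_vec a \<bullet> c = 1"
  shows "cball c r \<inter> weighted_hyperplane a 1 \<subseteq> weighted_simplex a 1 \<longleftrightarrow>
    (\<forall>b. real_vec a \<bullet> b = 0 \<longrightarrow> norm b \<le> r \<longrightarrow> (\<forall>i. 0 \<le> (c + b) $ i))" (is "?L \<longleftrightarrow> ?R")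
proof
  assume L: ?L
  show ?R
  proof (intro allI impI)
    fix b i assume "real_vec a \<bullet> b = 0" "norm b \<le> r"
    then have "c + b \<in> cball c r \<inter> weighted_hyperplane a 1"
      using assms by (simp add: weighted_hyperplane_def real_vec_inner[symmetric]
          inner_add_right dist_norm)
    with L show "0 \<le> (c + b) $ i" by (auto simp: weighted_simplex_def)
  qed
next
  assume R: ?R
  show ?L
  proof
    fix x assume x: "x \<in> cball c r \<inter> weighted_hyperplane a 1"
    then have "real_vec a \<bullet> (x - c) = 0" "norm (x - c) \<le> r"
      using assms by (auto simp: weighted_hyperplane_def real_vec_inner[symmetric]
          inner_diff_right dist_norm norm_minus_commute)
    then have "\<forall>i. 0 \<le> (c + (x - c)) $ i" using R by blast
    then show "x \<in> weighted_simplex a 1" using x by (simp add: weighted_simplex_def)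
  qed
qed

lemma inradius_eq:
  fixes a :: "nat ^ 'n"
  shows "inradius a 1 = Sup {r. 0 < r \<and> (\<exists>c. real_vec a \<bullet> c = 1 \<and>
    (\<forall>b. real_vec a \<bullet> b = 0 \<longrightarrow> norm b \<le> r \<longrightarrow> (\<forall>i. 0 \<le> (c + b) $ i)))}"
proof -
  have "{r. 0 < r \<and> (\<exists>c \<in> weighted_hyperplane a 1.
      cball c r \<inter> weighted_hyperplane a 1 \<subseteq> weighted_simplex a 1)} =
    {r. 0 < r \<and> (\<exists>c. real_vec a \<bullet> c = 1 \<and>
    (\<forall>b. real_vec a \<bullet> b = 0 \<longrightarrow> norm b \<le> r \<longrightarrow> (\<forall>i. 0 \<le> (c + b) $ i)))}"
    using inscribed_ball_iff[of a]
    by (auto simp: weighted_hyperplane_def real_vec_inner[symmetric] Bex_def)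
  then show ?thesis unfolding inradius_def by simp
qed

lemma inscribed_ball_exists:
  fixes a :: "nat ^ 'n"
  assumes "\<And>i. a $ i > 0"
  shows "\<exists>r>0. \<exists>c. real_vec a \<bullet> c = 1 \<and>
    (\<forall>b. real_vec a \<bullet> b = 0 \<longrightarrow> norm b \<le> r \<longrightarrow> (\<forall>i. 0 \<le> (c + b) $ i))"
proof -
  \<comment> \<open>The barycentre of the simplex. Its smallest coordinate serves as radius, since
    no coordinate of \<open>b\<close> exceeds \<open>norm b\<close> in absolute value.\<close>
  define c :: "real ^ 'n" where "c = (\<chi> i. 1 / (real CARD('n) * real (a $ i)))"
  define r where "r = Min (range (($) c))"
  have c: "c $ i > 0" for i using assms by (simp add: c_def)
  have "r \<in> range (($) c)" unfolding r_def by (rule Min_in) auto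
  then have "r > 0" using c by auto
  moreover have "real_vec a \<bullet> c = 1"
    using assms by (simp add: real_vec_inner c_def less_imp_neq[symmetric])
  moreover have "0 \<le> (c + b) $ i" if "norm b \<le> r" for b i
  proof -
    have "r \<le> c $ i" unfolding r_def by (rule Min_le) auto
    moreover have "\<bar>b $ i\<bar> \<le> norm b" by (rule component_le_norm_cart)
    ultimately show ?thesis using that by simp
  qed
  ultimately show ?thesis by blast
qed

text \<open>With at least two coordinates the hyperplane contains a nonzero direction
  \<open>u\<close>. The centre and a point at distance \<open>r\<close> from it along
  \<open>u\<close> both lie in the bounded simplex, which limits \<open>r\<close>. In dimension one
  the hyperplane is a single point and every radius would qualify.\<close>

lemma inscribed_ball_bounded:
  fixes a :: "nat ^ 'n"
  assumes card: "CARD('n) \<ge> 2" and pos: "\<And>i. a $ i > 0"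
  shows "bdd_above {r. 0 < r \<and> (\<exists>c. real_vec a \<bullet> c = 1 \<and>
    (\<forall>b. real_vec a \<bullet> b = 0 \<longrightarrow> norm b \<le> r \<longrightarrow> (\<forall>i. 0 \<le> (c + b) $ i)))}"
proof -
  obtain i j :: 'n where ij: "i \<noteq> j"
    using card card_le_Suc0_iff_eq[of "UNIV :: 'n set"] by auto
  define u where "u = real (a $ j) *\<^sub>R axis i 1 - real (a $ i) *\<^sub>R axis j (1::real)"
  have u0: "real_vec a \<bullet> u = 0" by (simp add: u_def inner_diff_right inner_axis)
  have "u $ i \<noteq> 0" using ij pos[of j] by (simp add: u_def axis_def)
  then have u: "norm u > 0" by auto
  have "bounded {x. (\<forall>i. 0 \<le> x $ i) \<and> real_vec a \<bullet> x \<le> 1}"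
    by (intro compact_imp_bounded compact_corner_simplex) (auto simp: pos)
  then obtain B where B: "\<And>x. (\<forall>i. 0 \<le> x $ i) \<Longrightarrow> real_vec a \<bullet> x \<le> 1 \<Longrightarrow> norm x \<le> B"
    unfolding bounded_iff by blast
  show ?thesis
  proof (rule bdd_aboveI)
    fix r assume "r \<in> {r. 0 < r \<and> (\<exists>c. real_vec a \<bullet> c = 1 \<and>
      (\<forall>b. real_vec a \<bullet> b = 0 \<longrightarrow> norm b \<le> r \<longrightarrow> (\<forall>i. 0 \<le> (c + b) $ i)))}"
    then obtain c where r: "0 < r" and c: "real_vec a \<bullet> c = 1"
      and *: "\<And>b i. real_vec a \<bullet> b = 0 \<Longrightarrow> norm b \<le> r \<Longrightarrow> 0 \<le> (c + b) $ i" by blast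
    define b where "b = (r / norm u) *\<^sub>R u"
    have b: "real_vec a \<bullet> b = 0" "norm b = r" using u0 u r by (auto simp: b_def)
    have "norm (c + b) \<le> B" using b c * by (intro B) (auto simp: inner_add_right)
    moreover have "norm c \<le> B" using *[of 0] r c by (intro B) auto
    moreover have "norm b \<le> norm (c + b) + norm c"
      using norm_triangle_ineq4[of "c + b" c] by simp
    ultimately show "r \<le> 2 * B" using b by linarith
  qed
qed

lemma inradius_pos:
  fixes a :: "nat ^ 'n"
  assumes "CARD('n) \<ge> 2" and "\<And>i. a $ i > 0"
  shows "0 < inradius a 1"
proof -
  obtain r where r: "0 < r" "\<exists>c. real_vec a \<bullet> c = 1 \<and>
    (\<forall>b. real_vec a \<bullet> b = 0 \<longrightarrow> norm b \<le> r \<longrightarrow> (\<forall>i. 0 \<le> (c + b) $ i))"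
    using inscribed_ball_exists[OF assms(2)] by blast
  then have "r \<le> inradius a 1"
    unfolding inradius_eq by (intro cSup_upper inscribed_ball_bounded[OF assms]) auto
  with r show ?thesis by simp
qed

lemma less_inradius:
  fixes a :: "nat ^ 'n"
  assumes "\<And>i. a $ i > 0" and "r < inradius a 1"
  obtains c where "real_vec a \<bullet> c = 1"
    "\<And>b i. real_vec a \<bullet> b = 0 \<Longrightarrow> norm b \<le> r \<Longrightarrow> 0 \<le> (c + b) $ i"
proof -
  have "\<exists>r'\<in>{r. 0 < r \<and> (\<exists>c. real_vec a \<bullet> c = 1 \<and>
    (\<forall>b. real_vec a \<bullet> b = 0 \<longrightarrow> norm b \<le> r \<longrightarrow> (\<forall>i. 0 \<le> (c + b) $ i)))}. r < r'"
    using assms(2) inscribed_ball_exists[OF assms(1)]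
    unfolding inradius_eq by (intro less_cSupD) auto
  then obtain r' c where "r < r'" "real_vec a \<bullet> c = 1"
    "\<forall>b. real_vec a \<bullet> b = 0 \<longrightarrow> norm b \<le> r' \<longrightarrow> (\<forall>i. 0 \<le> (c + b) $ i)" by blast
  then show thesis using that[of c] by (meson less_imp_le order.trans)
qed

section \<open>Counting representations\<close>

lemma finite_representations:
  fixes a :: "nat ^ 'n"
  assumes "\<And>i. a $ i > 0"
  shows "finite (representations a t)"
proof (rule finite_subset)
  show "representations a t \<subseteq> vec_lambda ` (UNIV \<rightarrow>\<^sub>E {..t})"
  proof
    fix x assume x: "x \<in> representations a t"
    have "x $ i \<le> t" for i
    proof -
      have "x $ i \<le> a $ i * x $ i" using assms[of i] by simp
      also have "\<dots> \<le> (\<Sum>i\<in>UNIV. a $ i * x $ i)" by (rule member_le_sum) auto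
      finally show ?thesis using x by (simp add: representations_def)
    qed
    then show "x \<in> vec_lambda ` (UNIV \<rightarrow>\<^sub>E {..t})"
      by (intro image_eqI[where x="($) x"]) (auto simp: vec_nth_inverse)
  qed
  show "finite (vec_lambda ` (UNIV \<rightarrow>\<^sub>E {..t}) :: (nat ^ 'n) set)"
    by (intro finite_imageI finite_PiE) auto
qed

text \<open>Coprimality enters here: multiples of \<open>z\<close> provide integer points on every
  integer level of \<open>a \<bullet> x\<close>.\<close>

lemma bezout_real_vec:
  fixes a :: "nat ^ 'n"
  assumes "Gcd (range (($) a)) = 1"
  obtains z where "\<And>i. z $ i \<in> \<int>" "real_vec a \<bullet> z = 1"
proof -
  obtain m where m: "(\<Sum>i\<in>UNIV. int (a $ i) * m i) = Gcd (range (\<lambda>i. int (a $ i)))"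
    using bezout_finite_family[of UNIV "\<lambda>i. int (a $ i)"] by auto
  also have "\<dots> = 1"
    using Gcd_int_eq[of "range (($) a)"] assms by (simp add: image_image)
  finally have "real_of_int (\<Sum>i\<in>UNIV. int (a $ i) * m i) = 1" by simp
  then show thesis
    by (intro that[of "\<chi> i. of_int (m i)"]) (auto simp: real_vec_inner)
qed

lemma nonneg_integer_point_representation:
  fixes a :: "nat ^ 'n"
  assumes "\<And>i. z $ i \<in> \<int>" "\<And>i. 0 \<le> z $ i" "real_vec a \<bullet> z = real t"
  obtains y where "y \<in> representations a t" "z = real_vec y"
proof -
  define y :: "nat ^ 'n" where "y = (\<chi> i. nat \<lfloor>z $ i\<rfloor>)"
  have z: "z = real_vec y"
    using assms(1,2) by (auto simp: vec_eq_iff y_def of_nat_nat)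
  have "real (\<Sum>i\<in>UNIV. a $ i * y $ i) = real t"
    using assms(3) by (simp add: z real_vec_inner)
  then have "y \<in> representations a t"
    unfolding representations_def mem_Collect_eq by (rule of_nat_eq_iff[THEN iffD1])
  with z that show thesis by blast
qed

text \<open>A translate of the prism over the simplex at level \<open>t - R / r\<close> is covered
  by sets of measure at most one, one for each representation. The strict inequalities on
  \<open>R\<close> and \<open>r\<close> make the covering and the inscribed ball available without
  attaining the infimum or supremum.\<close>

lemma card_representations_ge:
  fixes a :: "nat ^ 'n"
  assumes pos: "\<And>i. a $ i > 0"
    and gcd: "Gcd (range (($) a)) = 1"
    and R: "covering_radius a < R" and r: "0 < r" "r < inradius a 1"
    and t: "R / r < real t"
  shows "(real t - R / r) ^ (CARD('n) - 1) / (fact (CARD('n) - 1) * (\<Prod>i\<in>UNIV. real (a $ i)))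
    \<le> real (card (representations a t))"
proof -
  define w where "w = real_vec a"
  have w: "w $ i > 0" for i using pos by (simp add: w_def)
  have R0: "0 < R" using R covering_radius_nonneg[OF pos] by simp
  define \<rho> where "\<rho> = R / r"
  have \<rho>: "0 < \<rho>" "R / \<rho> = r" using R0 r by (auto simp: \<rho>_def)
  define \<tau> where "\<tau> = real t - \<rho>"
  have \<tau>: "0 < \<tau>" using t by (simp add: \<tau>_def \<rho>_def)
  obtain c where c: "w \<bullet> c = 1"
    "\<And>b i. w \<bullet> b = 0 \<Longrightarrow> norm b \<le> r \<Longrightarrow> 0 \<le> (c + b) $ i"
    using less_inradius[OF pos r(2)] unfolding w_def by blast
  obtain z0 where z0: "\<And>i. z0 $ i \<in> \<int>" "w \<bullet> z0 = 1"
    using bezout_real_vec[OF gcd] unfolding w_def by blast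
  obtain j :: 'n where True by blast
  \<comment> \<open>A vertex of the simplex at level 1, used as thickening direction: it is
    nonnegative and lies on level 1.\<close>
  define p where "p = axis j (1 / w $ j)"
  have p: "0 \<le> p $ i" for i using w[of j] by (simp add: p_def axis_def)
  have wp: "w \<bullet> p = 1" using w[of j] by (simp add: p_def inner_axis)
  \<comment> \<open>The ball of radius \<open>R\<close> in the hyperplane through the origin, swept
    along \<open>p\<close> through the levels above 0 up to 1. The half-open range makes the level
    of the integer translate unique.\<close>
  define C where "C = {y. 0 < w \<bullet> y \<and> w \<bullet> y \<le> 1 \<and> norm (y - (w \<bullet> y) *\<^sub>R p) \<le> R}"
  have "C = {y. 0 < w \<bullet> y} \<inter> {y. w \<bullet> y \<le> 1} \<inter> {y. norm (y - (w \<bullet> y) *\<^sub>R p) \<le> R}"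
    by (auto simp: C_def)
  also have "\<dots> \<in> sets borel"
    by (intro sets.Int borel_closed borel_open closed_Collect_le open_Collect_less continuous_intros)
  finally have C: "C \<in> sets borel" .
  have cover: "\<exists>z. (\<forall>i. z $ i \<in> \<int>) \<and> x - z \<in> C" for x
  proof -
    \<comment> \<open>Ceiling minus one, rather than floor, puts the remainder \<open>f\<close>
      above 0 and at most 1, as in \<open>C\<close>. Then \<open>k *\<^sub>R z0\<close> accounts for
      the level, and a lattice vector \<open>u\<close> approximates what remains in the
      hyperplane.\<close>
    define k where "k = real_of_int (\<lceil>w \<bullet> x\<rceil> - 1)"
    define f where "f = w \<bullet> x - k"
    have f: "0 < f" "f \<le> 1" unfolding f_def k_def by linarith+
    define v where "v = x - k *\<^sub>R z0 - f *\<^sub>R p"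
    have "w \<bullet> v = 0" by (simp add: v_def inner_diff_right z0 wp f_def)
    then obtain u where u: "u \<in> orthogonal_lattice a" "norm (v - u) \<le> R"
      using covering_radius_less[OF pos R, of v] unfolding w_def by blast
    define z where "z = k *\<^sub>R z0 + u"
    have wu: "w \<bullet> u = 0" using u by (simp add: orthogonal_lattice_iff w_def)
    have "w \<bullet> (x - z) = f"
      by (simp add: z_def inner_diff_right inner_add_right z0 wu f_def)
    moreover have "x - z - f *\<^sub>R p = v - u" by (simp add: z_def v_def algebra_simps)
    ultimately have "x - z \<in> C" using f u by (simp add: C_def)
    moreover have "\<forall>i. z $ i \<in> \<int>"
      using u(1) z0(1) by (auto simp: z_def k_def orthogonal_lattice_iff intro!: Ints_add Ints_mult Ints_diff)
    ultimately show ?thesis by blast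
  qed
  obtain F where F: "F \<subseteq> C" "F \<in> sets borel" "emeasure lborel F \<le> 1"
    "\<And>x. \<exists>z. (\<forall>i. z $ i \<in> \<int>) \<and> x - z \<in> F"
    using integer_translates_cover_small[OF C cover] by blast
  define P where "P = {x. \<tau> < w \<bullet> x \<and> w \<bullet> x \<le> \<tau> + 1 \<and> (\<forall>i. 0 \<le> (x - (w \<bullet> x - \<tau>) *\<^sub>R p) $ i)}"
  have P: "P \<in> sets borel" unfolding P_def by (rule sets_borel_prism)
  \<comment> \<open>An integer point \<open>z\<close> with \<open>x - z\<close> in \<open>F\<close>
    is shown to be a representation of \<open>t\<close>: its level is forced to be \<open>t\<close>,
    and its coordinates are nonnegative.\<close>
  have sub: "{x. x - \<rho> *\<^sub>R c \<in> P} \<subseteq> (\<Union>y\<in>representations a t. {x. x - real_vec y \<in> F})"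
  proof
    fix x assume "x \<in> {x. x - \<rho> *\<^sub>R c \<in> P}"
    then have x: "x - \<rho> *\<^sub>R c \<in> P" by simp
    have wx: "w \<bullet> (x - \<rho> *\<^sub>R c) - \<tau> = w \<bullet> x - real t"
      by (simp add: inner_diff_right c \<tau>_def)
    with x have x1: "real t < w \<bullet> x" "w \<bullet> x \<le> real t + 1"
      by (auto simp: P_def)
    from x have x2: "0 \<le> (x - \<rho> *\<^sub>R c - (w \<bullet> x - real t) *\<^sub>R p) $ i" for i
      unfolding P_def mem_Collect_eq wx by blast
    obtain z where z: "\<And>i. z $ i \<in> \<int>" "x - z \<in> F" using F(4) by blast
    then have zC: "x - z \<in> C" using F by blast
    have "w \<bullet> z \<in> \<int>"
      unfolding w_def real_vec_inner using z by (intro Ints_sum Ints_mult) auto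
    then obtain m where m: "w \<bullet> z = of_int m" by (auto elim: Ints_cases)
    have "w \<bullet> z < w \<bullet> x" "w \<bullet> x \<le> w \<bullet> z + 1"
      using zC by (auto simp: C_def inner_diff_right)
    \<comment> \<open>\<open>w \<bullet> x\<close> exceeds both \<open>t\<close> and the integer
      \<open>w \<bullet> z\<close>, each by at most one, so the two differ by less than one.\<close>
    then have "m = int t" using x1 m by linarith
    then have wz: "w \<bullet> z = real t" using m by simp
    \<comment> \<open>The displacement of \<open>x\<close> from \<open>z\<close> within the
      hyperplane. Scaled by \<open>1 / \<rho>\<close> its norm is at most
      \<open>R / \<rho> = r\<close>, so it fits into the ball inscribed around
      \<open>c\<close>.\<close>
    define b where "b = x - z - (w \<bullet> x - real t) *\<^sub>R p"
    have "norm b \<le> R" using zC by (simp add: C_def b_def inner_diff_right wz)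
    then have "norm ((- 1 / \<rho>) *\<^sub>R b) \<le> r"
      using \<rho> divide_right_mono[of "norm b" R \<rho>] by simp
    moreover have "w \<bullet> ((- 1 / \<rho>) *\<^sub>R b) = 0" by (simp add: b_def inner_diff_right wp wz)
    ultimately have cb: "0 \<le> (c + (- 1 / \<rho>) *\<^sub>R b) $ i" for i using c(2) by blast
    define y where "y = x - \<rho> *\<^sub>R c - (w \<bullet> x - real t) *\<^sub>R p"
    define c' where "c' = c + (- 1 / \<rho>) *\<^sub>R b"
    \<comment> \<open>Here \<open>y\<close> lies in the simplex at level \<open>\<tau>\<close> and
      \<open>c'\<close> in the one at level 1, so \<open>z\<close> is a sum of nonnegative
      vectors.\<close>
    have "z = y + \<rho> *\<^sub>R c'" using \<rho> by (simp add: b_def y_def c'_def algebra_simps)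
    moreover have "0 \<le> y $ i" "0 \<le> c' $ i" for i using x2 cb unfolding y_def c'_def by blast+
    ultimately have "0 \<le> z $ i" for i using \<rho>(1) by simp
    then obtain y where "y \<in> representations a t" "z = real_vec y"
      using nonneg_integer_point_representation[of z a t] z(1) wz unfolding w_def by blast
    then show "x \<in> (\<Union>y\<in>representations a t. {x. x - real_vec y \<in> F})" using z by blast
  qed
  note fin = finite_representations[OF pos, of t]
  have "ennreal (\<tau> ^ (CARD('n) - 1) / (fact (CARD('n) - 1) * (\<Prod>i\<in>UNIV. w $ i))) \<le> emeasure lborel P"
    unfolding P_def by (rule emeasure_prism_ge[OF w \<tau> p wp])
  also have "\<dots> = emeasure lborel {x. x - \<rho> *\<^sub>R c \<in> P}" by (rule emeasure_lborel_shift[OF P, symmetric])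
  also have "\<dots> \<le> emeasure lborel (\<Union>y\<in>representations a t. {x. x - real_vec y \<in> F})"
    using sub sets_borel_shift[OF F(2)] fin
    by (intro emeasure_mono) (auto intro!: sets.finite_UN)
  also have "\<dots> \<le> (\<Sum>y\<in>representations a t. emeasure lborel {x. x - real_vec y \<in> F})"
    using sets_borel_shift[OF F(2)] fin by (intro emeasure_subadditive_finite) auto
  also have "\<dots> \<le> (\<Sum>y\<in>representations a t. 1)"
    using F(3) by (intro sum_mono) (simp add: emeasure_lborel_shift[OF F(2)])
  also have "\<dots> = ennreal (real (card (representations a t)))"
    by (simp add: ennreal_of_nat_eq_real_of_nat)
  finally show ?thesis
    by (simp add: ennreal_le_iff \<tau>_def \<rho>_def w_def)
qed

text \<open>For every \<open>\<rho>\<close> between \<open>q\<close> and \<open>t\<close> there is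
  an \<open>r\<close> below the inradius such that \<open>\<rho> * r\<close> exceeds the covering
  radius. The previous bound with \<open>R = \<rho> * r\<close> then has ratio exactly
  \<open>\<rho>\<close>, and \<open>\<rho>\<close> tends to \<open>q\<close> from the right.\<close>

lemma card_representations_ge_limit:
  fixes a :: "nat ^ 'n"
  assumes card: "CARD('n) \<ge> 2" and pos: "\<And>i. a $ i > 0"
    and gcd: "Gcd (range (($) a)) = 1"
    and t: "covering_radius a / inradius a 1 < real t"
  shows "(real t - covering_radius a / inradius a 1) ^ (CARD('n) - 1)
    \<le> real (card (representations a t)) * fact (CARD('n) - 1) * (\<Prod>i\<in>UNIV. real (a $ i))"
proof -
  define q where "q = covering_radius a / inradius a 1"
  note r0 = inradius_pos[OF card pos] and R0 = covering_radius_nonneg[OF pos]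
  have q0: "0 \<le> q" using r0 R0 by (simp add: q_def)
  have prod: "0 < fact (CARD('n) - 1) * (\<Prod>i\<in>UNIV. real (a $ i))"
    using pos by (intro mult_pos_pos prod_pos) auto
  have bound: "(real t - \<rho>) ^ (CARD('n) - 1)
      \<le> real (card (representations a t)) * fact (CARD('n) - 1) * (\<Prod>i\<in>UNIV. real (a $ i))"
    if \<rho>: "\<rho> \<in> {q<..<real t}" for \<rho>
  proof -
    have \<rho>0: "0 < \<rho>" using \<rho> q0 by auto
    have "covering_radius a / \<rho> < inradius a 1"
      using \<rho> \<rho>0 r0 by (auto simp: q_def field_simps)
    then obtain r where r: "covering_radius a / \<rho> < r" "r < inradius a 1" using dense by blast
    have "0 \<le> covering_radius a / \<rho>" using \<rho>0 R0 by simp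
    with r have r1: "0 < r" by linarith
    have "covering_radius a < \<rho> * r" using r(1) \<rho>0 by (simp add: field_simps)
    from card_representations_ge[OF pos gcd this r1 r(2), of t] \<rho> r1 prod
    show ?thesis by (simp add: pos_divide_le_eq mult.assoc)
  qed
  have "((\<lambda>\<rho>. (real t - \<rho>) ^ (CARD('n) - 1)) \<longlongrightarrow> (real t - q) ^ (CARD('n) - 1)) (at_right q)"
    by (intro tendsto_intros)
  moreover have "\<forall>\<^sub>F \<rho> in at_right q. (real t - \<rho>) ^ (CARD('n) - 1)
      \<le> real (card (representations a t)) * fact (CARD('n) - 1) * (\<Prod>i\<in>UNIV. real (a $ i))"
    using eventually_at_right_real[of q "real t"] t bound
    by (auto simp: q_def elim!: eventually_mono)
  ultimately show ?thesis
    unfolding q_def[symmetric] by (rule tendsto_upperbound) simp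
qed

section \<open>Bernoulli's inequality and the final bound\<close>

text \<open>With \<open>K = n q + 1\<close>, Bernoulli gives
  \<open>(1 - q / t) ^ n >= 1 - (K - 1) / t\<close>, and the right side is at least
  \<open>1 / K\<close> because \<open>t >= K >= 1\<close>.\<close>

lemma power_le_Bernoulli:
  fixes q t :: real
  assumes q: "0 \<le> q" and n: "1 \<le> n" and t: "real n * q + 1 \<le> t"
  shows "t ^ n \<le> (real n * q + 1) * (t - q) ^ n"
proof -
  define K where "K = real n * q + 1"
  have K: "1 \<le> K" "K \<le> t" using q t by (auto simp: K_def)
  then have t0: "0 < t" by linarith
  \<comment> \<open>Yields \<open>q <= t\<close>, so that \<open>- q / t\<close> is at least -1 and
    Bernoulli's inequality applies.\<close>
  have "1 * q \<le> real n * q" using n q by (intro mult_right_mono) auto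
  then have "q \<le> t" using t by simp
  have "K * (K - 1) \<le> t * (K - 1)" using K by (intro mult_right_mono) auto
  then have "1 \<le> K * (1 - (K - 1) / t)" using t0 by (simp add: field_simps)
  also have "1 - (K - 1) / t = 1 + real n * (- (q / t))" by (simp add: K_def)
  also have "K * \<dots> \<le> K * (1 + (- (q / t))) ^ n"
    using K t0 \<open>q \<le> t\<close> by (intro mult_left_mono Bernoulli_inequality) auto
  finally have "t ^ n * 1 \<le> t ^ n * (K * (1 + (- (q / t))) ^ n)"
    using t0 by (intro mult_left_mono) auto
  also have "\<dots> = K * (t * (1 + (- (q / t)))) ^ n" by (simp add: power_mult_distrib)
  also have "t * (1 + (- (q / t))) = t - q" using t0 by (simp add: field_simps)
  finally show ?thesis by (simp add: K_def)
qed

theorem theorem5p4: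
  fixes a :: "nat ^ 'n" and s :: nat
  assumes "CARD('n) \<ge> 2"
    and "\<And>i. a $ i > 0"
    and "Gcd (range (($) a)) = 1"
  shows "real (frobenius_number s a) \<le>
    max ((real CARD('n) - 1) * covering_radius a / inradius a 1 + 1)
        ((((real CARD('n) - 1) * covering_radius a / inradius a 1 + 1)
            * real s * fact (CARD('n) - 1) * (\<Prod>i\<in>UNIV. real (a $ i)))
          powr (1 / (real CARD('n) - 1)))"
    (is "_ \<le> max ?K (?M powr _)")
proof -
  define n where "n = CARD('n) - 1"
  have n: "1 \<le> n" "real CARD('n) - 1 = real n" using assms(1) by (auto simp: n_def)
  define q where "q = covering_radius a / inradius a 1"
  have q0: "0 \<le> q"
    using inradius_pos[OF assms(1,2)] covering_radius_nonneg[OF assms(2)] by (simp add: q_def)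
  have K: "?K = real n * q + 1" by (simp add: n q_def)
  \<comment> \<open>Every \<open>t\<close> with exactly \<open>s\<close> representations obeys the
    bound, not only the largest. This also makes \<open>T\<close> finite below, so that
    \<open>Max T\<close> belongs to \<open>T\<close>.\<close>
  have bound: "real t \<le> max ?K (?M powr (1 / (real CARD('n) - 1)))"
    if t: "card (representations a t) = s" for t
  proof (cases "real t \<le> ?K")
    case False
    have "1 * q \<le> real n * q" using n q0 by (intro mult_right_mono) auto
    with False have "q < real t" by (simp add: K)
    then have "(real t - q) ^ n \<le> real s * fact n * (\<Prod>i\<in>UNIV. real (a $ i))"
      using card_representations_ge_limit[OF assms, of t] t unfolding q_def n_def by simp
    then have "?K * (real t - q) ^ n \<le> ?K * (real s * fact n * (\<Prod>i\<in>UNIV. real (a $ i)))"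
      using q0 by (intro mult_left_mono) (auto simp: K)
    moreover have "real t ^ n \<le> ?K * (real t - q) ^ n"
      unfolding K using power_le_Bernoulli[OF q0 n(1), of "real t"] False by (simp add: K)
    ultimately have M: "real t ^ n \<le> ?M" by (simp add: n_def mult.assoc)
    have t0: "0 < real t" using \<open>q < real t\<close> q0 by linarith
    have "real t = (real t ^ n) powr (1 / real n)"
      using t0 n by (simp add: powr_realpow[symmetric] powr_powr)
    also have "\<dots> \<le> ?M powr (1 / real n)"
      using M t0 by (intro powr_mono2) auto
    finally show ?thesis by (simp add: n(2) le_max_iff_disj)
  qed simp
  define T where "T = {t. 0 < t \<and> card (representations a t) = s}"
  show ?thesis
  proof (cases "T = {}")
    case True
    \<comment> \<open>The conventional value 0 is covered by the first entry of the maximum, which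
      is at least 1.\<close>
    then have "frobenius_number s a = 0" by (simp add: frobenius_number_def T_def)
    then show ?thesis using q0 by (simp add: K le_max_iff_disj)
  next
    case False
    have "finite T"
    proof (rule finite_subset)
      show "T \<subseteq> {..nat \<lfloor>max ?K (?M powr (1 / (real CARD('n) - 1)))\<rfloor>}"
        using bound by (auto simp: T_def le_nat_floor)
    qed simp
    then have "Max T \<in> T" using False by (rule Max_in)
    moreover have "frobenius_number s a = Max T"
      using False by (simp add: frobenius_number_def T_def[symmetric] Let_def)
    ultimately show ?thesis using bound by (simp add: T_def)
  qed
qed

end
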